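(* (a) There exists a nontrivial minimal blocking set of size $7$ in $PG(3,3)$. (b) There exists a nontrivial minimal blocking set of size $8$ in $PG(3,3)$. (c) There exists a nontrivial minimal blocking set of size $9$ in $PG(4,3)$.
   Context: $PG(n,q)$ is the $n$-dimensional projective space over the finite field $\mathbb{F}_q$: its points are the one-dimensional subspaces of $(\mathbb{F}_q)^{n+1}$, and its hyperplanes correspond to the $n$-dimensional linear subspaces of $(\mathbb{F}_q)^{n+1}$. A blocking set in $PG(n,q)$ is a set of points having nonempty intersection with every hyperplane of $PG(n,q)$. A blocking set is trivial if it contains a line, and nontrivial otherwise. A blocking set is minimal if none of its proper subsets is a blocking set. *)

theory Defs
  imports
    "HOL-Analysis.Cartesian_Space"
    "HOL-Library.Numeral_Type"
    "Berlekamp_Zassenhaus.Finite_Field"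
begin

text \<open>
  The projective space of dimension \<open>CARD('n) - 1\<close> over the field \<open>'f\<close>, with underlying vector
  space \<open>'f ^ 'n\<close>.  Points, lines and hyperplanes are linear subspaces, so that incidence is
  inclusion.  Thus \<open>PG(n,q)\<close> is obtained from a field \<open>'f\<close> with \<open>q\<close> elements and an index type
  with \<open>n + 1\<close> elements, for instance \<open>'f ^ 4\<close> for \<open>PG(3,q)\<close>.
\<close>

definition pg_points :: "('f::field ^ 'n) set set" where
  "pg_points = {P. vec.subspace P \<and> vec.dim P = 1}"

definition pg_lines :: "('f::field ^ 'n) set set" where
  "pg_lines = {L. vec.subspace L \<and> vec.dim L = 2}"

definition pg_hyperplanes :: "('f::field ^ 'n) set set" where
  "pg_hyperplanes = {H. vec.subspace H \<and> vec.dim H = CARD('n) - 1}"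

definition blocking_set :: "('f::field ^ 'n) set set \<Rightarrow> bool" where
  "blocking_set B \<longleftrightarrow> B \<subseteq> pg_points \<and> (\<forall>H\<in>pg_hyperplanes. \<exists>P\<in>B. P \<subseteq> H)"

definition trivial_blocking_set :: "('f::field ^ 'n) set set \<Rightarrow> bool" where
  "trivial_blocking_set B \<longleftrightarrow>
     blocking_set B \<and> (\<exists>L\<in>pg_lines. {P \<in> pg_points. P \<subseteq> L} \<subseteq> B)"

definition nontrivial_blocking_set :: "('f::field ^ 'n) set set \<Rightarrow> bool" where
  "nontrivial_blocking_set B \<longleftrightarrow> blocking_set B \<and> \<not> trivial_blocking_set B"

definition minimal_blocking_set :: "('f::field ^ 'n) set set \<Rightarrow> bool" where
  "minimal_blocking_set B \<longleftrightarrow> blocking_set B \<and> (\<forall>B'. B' \<subset> B \<longrightarrow> \<not> blocking_set B')"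

text \<open>
  The field with \<open>q = 3\<close> elements is represented by an arbitrary type of class \<open>field\<close> with three
  elements.  The type \<open>3 mod_ring\<close> is not known to be a field, because \<open>prime_card\<close> has no instance
  for numeral types; the following index type provides a type of class \<open>field\<close> with three elements.
\<close>

datatype three = Three0 | Three1 | Three2

lemma UNIV_three: "(UNIV :: three set) = {Three0, Three1, Three2}"
  using three.exhaust by auto

instance three :: finite
  by standard (simp add: UNIV_three)

lemma card_three: "CARD(three) = 3"
  by (simp add: UNIV_three)

instance three :: prime_card
  by standard (simp add: card_three)

lemma field_with_three_elements: "CARD(three mod_ring) = 3" "OFCLASS(three mod_ring, field_class)"
   apply (simp add: card_three)
  by intro_classes

end

theory Submission
  imports Defs
begin

text \<open>
  Every hyperplane is the kernel of a nonzero functional \<open>x \<mapsto> a \<bullet> x\<close>, so a list of vectors spans a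
  blocking set as soon as every \<open>a\<close> is orthogonal to one of them, and this blocking set is minimal
  if each vector \<open>v\<close> has a witness \<open>a\<close> orthogonal to \<open>v\<close> and to no other vector of the list.
  A line is itself a blocking set, hence a minimal blocking set containing a line equals that line;
  therefore a minimal blocking set with three non-collinear points is nontrivial.

  In a field with three elements, two distinct nonzero elements have sum \<open>0\<close>.  Thus if the
  coordinates \<open>a, b, c, d\<close> are nonzero, then \<open>a - b\<close>, \<open>c - d\<close> or \<open>a + b + c + d\<close> vanishes, which
  yields seven points in \<open>PG(3,3)\<close>; likewise \<open>a - b\<close>, \<open>b - c\<close>, \<open>c - d\<close> or \<open>a + d\<close> vanishes,
  which yields eight.  With a fifth coordinate \<open>e\<close>, one of \<open>a - b\<close>, \<open>c - d\<close>, \<open>d - e\<close>,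
  \<open>a + b + c - e\<close> vanishes, which yields nine points in \<open>PG(4,3)\<close>.
\<close>

section \<open>Hyperplanes as kernels\<close>

definition dot :: "'f::field ^ 'n \<Rightarrow> 'f ^ 'n \<Rightarrow> 'f" where
  "dot a x = (\<Sum>i\<in>UNIV. a $ i * x $ i)"

lemma dot_zero [simp]: "dot a 0 = 0"
  by (simp add: dot_def)

lemma dot_add: "dot a (x + y) = dot a x + dot a y"
  by (simp add: dot_def algebra_simps sum.distrib)

lemma dot_diff: "dot a (x - y) = dot a x - dot a y"
  by (simp add: dot_def algebra_simps sum_subtractf)

lemma dot_scale: "dot a (c *s x) = c * dot a x"
  by (simp add: dot_def sum_distrib_left algebra_simps)

lemma dot_axis: "dot a (axis i 1) = a $ i"
  by (simp add: dot_def axis_def if_distrib cong: if_cong)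

lemma subspace_kernel_dot: "vec.subspace {x. dot a x = 0}"
  by (simp add: vec.subspace_def dot_add dot_scale)

lemma span_subset_kernel_dot:
  "(\<And>x. x \<in> S \<Longrightarrow> dot a x = 0) \<Longrightarrow> vec.span S \<subseteq> {x. dot a x = 0}"
  by (rule vec.span_minimal[OF _ subspace_kernel_dot]) auto

text \<open>If \<open>dot a w\<close> is nonzero, every vector differs from an element of the kernel
  by a multiple of \<open>w\<close>. Hence \<open>w\<close> together with the kernel spans the whole
  space, and inserting \<open>w\<close> raises the dimension by exactly one.\<close>

lemma dim_kernel_dot:
  fixes a :: "'f::field ^ 'n"
  assumes "a \<noteq> 0"
  shows "vec.dim {x. dot a x = 0} = CARD('n) - 1"
proof -
  let ?K = "{x. dot a x = 0}"
  obtain i where i: "a $ i \<noteq> 0"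
    using assms by (auto simp: vec_eq_iff)
  define w :: "'f ^ 'n" where "w = axis i 1"
  have w: "dot a w \<noteq> 0"
    using i by (simp add: w_def dot_axis)
  have K: "vec.span ?K = ?K"
    by (rule vec.span_eq_iff[THEN iffD2, OF subspace_kernel_dot])
  have "x \<in> vec.span (insert w ?K)" for x
  proof -
    have "x - (dot a x / dot a w) *s w \<in> vec.span ?K"
      using w by (intro vec.span_base) (simp add: dot_diff dot_scale)
    then show ?thesis
      by (auto simp: vec.span_insert)
  qed
  then have "vec.span (insert w ?K) = UNIV"
    by auto
  then have "vec.dim (insert w ?K) = vec.dim (UNIV :: ('f ^ 'n) set)"
    by (metis vec.dim_span)
  moreover have "w \<notin> vec.span ?K"
    using w by (simp add: K)
  ultimately show ?thesis
    by (simp add: vec.dim_insert vec_dim_card vec.dimension_def card_cart_basis del: vec.dim_UNIV)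
qed

lemma kernel_dot_in_pg_hyperplanes:
  "a \<noteq> 0 \<Longrightarrow> {x. dot a x = 0} \<in> pg_hyperplanes"
  by (simp add: pg_hyperplanes_def subspace_kernel_dot dim_kernel_dot)

lemma pg_hyperplane_eq_kernel_dot:
  fixes H :: "('f::field ^ 'n) set"
  assumes "H \<in> pg_hyperplanes"
  obtains a where "a \<noteq> 0" "H = {x. dot a x = 0}"
proof -
  have H: "vec.subspace H" "vec.dim H = CARD('n) - 1"
    using assms by (auto simp: pg_hyperplanes_def)
  have "H \<noteq> UNIV"
    using H(2) zero_less_card_finite[where 'a = 'n]
    by (auto simp: card_cart_basis simp del: zero_less_card_finite)
  then obtain w where w: "w \<notin> H"
    by auto
  obtain B where B: "B \<subseteq> H" "vec.independent B" "H \<subseteq> vec.span B"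
    using vec.basis_exists[of H] by metis
  have spanB: "vec.span B = H"
    using B H(1) by (simp add: vec.span_minimal subset_antisym)
  have "vec.independent (insert w B)"
    using B(2) w spanB by (simp add: vec.independent_insert)
  \<comment> \<open>\<open>g\<close> kills a basis of \<open>H\<close> and fixes one vector
    \<open>w\<close> outside \<open>H\<close>. A coordinate of \<open>g\<close> in which
    \<open>w\<close> is nonzero is then a nonzero functional vanishing on \<open>H\<close>; its
    coefficients form a row of the matrix of \<open>g\<close>.\<close>
  then obtain g where g: "Vector_Spaces.linear (*s) (*s) g"
      "\<forall>x\<in>insert w B. g x = (if x = w then w else 0)"
    using vec.linear_independent_extend[of "insert w B" "\<lambda>x. if x = w then w else 0"] by blast
  have gw: "g w = w"
    using g(2) by simp
  have "w \<noteq> 0"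
    using w vec.subspace_0[OF H(1)] by auto
  then obtain i where i: "w $ i \<noteq> 0"
    by (auto simp: vec_eq_iff)
  define a where "a = matrix g $ i"
  have dot_a: "dot a x = g x $ i" for x
    using matrix_works[OF g(1), of x] by (auto simp: a_def dot_def matrix_vector_mult_def vec_eq_iff)
  have "a \<noteq> 0"
    using dot_a[of w] gw i by (auto simp: dot_def)
  have "dot a x = 0" if "x \<in> B" for x
    using that g(2) w B(1) by (auto simp: dot_a)
  then have "H \<subseteq> {x. dot a x = 0}"
    using span_subset_kernel_dot[of B a] spanB by blast
  then have "H = {x. dot a x = 0}"
    using \<open>a \<noteq> 0\<close> H
    by (intro vec.subspace_dim_equal) (auto simp: subspace_kernel_dot dim_kernel_dot)
  with \<open>a \<noteq> 0\<close> show ?thesis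
    by (rule that)
qed

section \<open>Blocking sets from lists of vectors\<close>

lemma span_singleton_in_pg_points: "v \<noteq> 0 \<Longrightarrow> vec.span {v} \<in> pg_points"
  by (simp add: pg_points_def)

lemma span_singleton_subset_kernel_dot_iff:
  "vec.span {v} \<subseteq> {x. dot a x = 0} \<longleftrightarrow> dot a v = 0"
  using span_subset_kernel_dot[of "{v}" a] vec.span_base[of v "{v}"] by auto

lemma blocking_set_points_of_line:
  assumes "L \<in> pg_lines"
  shows "blocking_set {P \<in> pg_points. P \<subseteq> L}"
  unfolding blocking_set_def
proof (intro conjI ballI)
  show "{P \<in> pg_points. P \<subseteq> L} \<subseteq> pg_points"
    by auto
next
  fix H assume "H \<in> (pg_hyperplanes :: ('a ^ 'b) set set)"
  then obtain a where H: "H = {x. dot a x = 0}"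
    by (rule pg_hyperplane_eq_kernel_dot)
  have L: "vec.subspace L" "vec.dim L = 2"
    using assms by (auto simp: pg_lines_def)
  obtain B where B: "B \<subseteq> L" "vec.independent B" "card B = 2"
    using vec.basis_exists[of L] L(2) by metis
  obtain u w where uw: "B = {u, w}" "u \<noteq> w"
    using B(3) by (auto simp: card_2_iff)
  have ind: "w \<notin> vec.span {u}" "u \<noteq> 0"
    using B(2) uw vec.independent_insert[of w "{u}"] vec.dependent_zero[of B]
    by (auto simp: insert_commute[of u w])
  \<comment> \<open>A combination of the basis vectors of \<open>L\<close> on which
    \<open>dot a\<close> vanishes; it is nonzero because \<open>u\<close> and \<open>w\<close> are
    independent.\<close>
  define x where "x = (if dot a u = 0 then u else w - (dot a w / dot a u) *s u)"
  have "x \<in> L"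
    using B(1) uw L(1) by (auto simp: x_def intro: vec.subspace_diff vec.subspace_scale)
  moreover have "dot a x = 0"
    by (simp add: x_def dot_diff dot_scale)
  moreover have "x \<noteq> 0"
    using ind vec.span_scale[OF vec.span_base[of u "{u}"], of "dot a w / dot a u"]
    by (auto simp: x_def)
  ultimately have "vec.span {x} \<in> {P \<in> pg_points. P \<subseteq> L} \<and> vec.span {x} \<subseteq> H"
    using L(1) by (auto simp: H span_singleton_subset_kernel_dot_iff
        intro!: span_singleton_in_pg_points dest: vec.span_minimal[of "{x}" L, THEN subsetD, rotated 2])
  then show "\<exists>P\<in>{P \<in> pg_points. P \<subseteq> L}. P \<subseteq> H"
    by blast
qed

text \<open>The table in \<open>dual\<close> has \<open>True\<close> exactly on the diagonal, so one
  evaluation shows that the points are distinct and that the kernel of \<open>ws ! i\<close> meets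
  the set only in point \<open>i\<close>. The functional \<open>c\<close> separates the third point
  from the line through the first two.\<close>

lemma minimal_blocking_set_from_vectors:
  fixes vs ws :: "('f::field ^ 'n) list"
  assumes cover: "\<And>a. \<exists>v\<in>set vs. dot a v = 0"
    and dual: "map (\<lambda>w. map (\<lambda>v. dot w v = 0) vs) ws = map (\<lambda>i. map ((=) i) [0..<m]) [0..<m]"
    and len: "length vs = m" "3 \<le> m"
    and c: "dot c (vs ! 0) = 0" "dot c (vs ! 1) = 0" "dot c (vs ! 2) \<noteq> 0"
  shows "\<exists>B :: ('f ^ 'n) set set.
           nontrivial_blocking_set B \<and> minimal_blocking_set B \<and> card B = m"
proof -
  define p where "p i = vec.span {vs ! i}" for i
  define B where "B = p ` {..<m}"
  have D: "dot (ws ! i) (vs ! j) = 0 \<longleftrightarrow> i = j" if "i < m" "j < m" for i j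
  proof -
    have "length ws = m"
      using arg_cong[OF dual, of length] by simp
    then show ?thesis
      using arg_cong[OF dual, of "\<lambda>xss. xss ! i ! j"] that len by simp
  qed
  have p_subset: "p j \<subseteq> {x. dot (ws ! i) x = 0} \<longleftrightarrow> i = j" if "i < m" "j < m" for i j
    using D[OF that] by (simp add: p_def span_singleton_subset_kernel_dot_iff)
  \<comment> \<open>A zero vector would be orthogonal to every vector of the other list,
    contradicting the off-diagonal entries; these exist once there is a second index.\<close>
  have other: "\<exists>j<m. j \<noteq> i" for i
    using len by (intro exI[of _ "if i = 0 then 1 else 0"]) auto
  have nz: "vs ! i \<noteq> 0" if "i < m" for i
    using other[of i] D[OF _ that] by (metis dot_zero)
  have wnz: "ws ! i \<noteq> 0" if "i < m" for i
    using other[of i] D[OF that] by (auto simp: dot_def)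
  have points: "B \<subseteq> pg_points"
    using nz by (auto simp: B_def p_def intro: span_singleton_in_pg_points)
  have inj: "inj_on p {..<m}"
    using p_subset by (metis inj_onI lessThan_iff)
  then have card: "card B = m"
    by (simp add: B_def card_image)
  have blocking: "blocking_set B"
    unfolding blocking_set_def
  proof (intro conjI points ballI)
    fix H assume "H \<in> (pg_hyperplanes :: ('f ^ 'n) set set)"
    then obtain a where H: "H = {x. dot a x = 0}"
      by (rule pg_hyperplane_eq_kernel_dot)
    obtain i where "i < m" "dot a (vs ! i) = 0"
      using cover[of a] by (auto simp: in_set_conv_nth len)
    then have "p i \<in> B" "p i \<subseteq> H"
      unfolding B_def H p_def span_singleton_subset_kernel_dot_iff by auto
    then show "\<exists>P\<in>B. P \<subseteq> H"
      by blast
  qed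
  have minimal: "minimal_blocking_set B"
    unfolding minimal_blocking_set_def
  proof (intro conjI blocking allI impI notI)
    fix B' assume B': "B' \<subset> B" "blocking_set B'"
    then obtain i where i: "i < m" "p i \<notin> B'"
      by (auto simp: B_def)
    have "{x. dot (ws ! i) x = 0} \<in> pg_hyperplanes"
      by (rule kernel_dot_in_pg_hyperplanes[OF wnz[OF i(1)]])
    then obtain P where P: "P \<in> B'" "P \<subseteq> {x. dot (ws ! i) x = 0}"
      using B'(2) unfolding blocking_set_def by blast
    then obtain j where j: "j < m" "P = p j"
      using B'(1) by (auto simp: B_def)
    then show False
      using P i p_subset[OF i(1) j(1)] by simp
  qed
  have "\<not> trivial_blocking_set B"
  proof
    assume "trivial_blocking_set B"
    then obtain L where L: "L \<in> pg_lines" "{P \<in> pg_points. P \<subseteq> L} \<subseteq> B"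
      by (auto simp: trivial_blocking_set_def)
    then have B_eq: "B = {P \<in> pg_points. P \<subseteq> L}"
      using minimal blocking_set_points_of_line unfolding minimal_blocking_set_def by blast
    have in_L: "vs ! i \<in> L" if "i < m" for i
    proof -
      have "p i \<subseteq> L"
        using that B_eq by (auto simp: B_def)
      then show ?thesis
        using vec.span_base[of "vs ! i" "{vs ! i}"] by (auto simp: p_def)
    qed
    \<comment> \<open>\<open>ws ! 0\<close> vanishes on \<open>vs ! 0\<close> but not on
      \<open>vs ! 1\<close>. With \<open>c\<close>, this makes the first three vectors independent,
      too many for \<open>L\<close>.\<close>
    have "vs ! 1 \<notin> vec.span {vs ! 0}"
      using span_subset_kernel_dot[of "{vs ! 0}" "ws ! 0"] D[of 0 0] D[of 0 1] len by auto
    moreover have "vs ! 2 \<notin> vec.span {vs ! 1, vs ! 0}"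
      using span_subset_kernel_dot[of "{vs ! 1, vs ! 0}" c] c by auto
    ultimately have "vec.dim {vs ! 2, vs ! 1, vs ! 0} = 3"
      using nz[of 0] len by (simp add: vec.dim_insert)
    moreover have "vec.dim {vs ! 2, vs ! 1, vs ! 0} \<le> vec.dim L"
      using in_L len by (intro vec.dim_subset) auto
    ultimately show False
      using L(1) by (simp add: pg_lines_def)
  qed
  then show ?thesis
    using blocking minimal card unfolding nontrivial_blocking_set_def by blast
qed

section \<open>Coordinates\<close>

lemma exhaust_5:
  fixes x :: 5
  shows "x = 1 \<or> x = 2 \<or> x = 3 \<or> x = 4 \<or> x = 5"
proof (induct x)
  case (of_int z)
  then have "z = 0 \<or> z = 1 \<or> z = 2 \<or> z = 3 \<or> z = 4"
    by fastforce
  \<comment> \<open>The representatives run from 0 to 4, and 0 equals 5 in this type.\<close>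
  then show ?case
    by auto
qed

lemma UNIV_5: "UNIV = {1, 2, 3, 4, 5 :: 5}"
  using exhaust_5 by auto

lemma sum_5: "sum f (UNIV :: 5 set) = f 1 + f 2 + f 3 + f 4 + f 5"
  unfolding UNIV_5 by (simp add: ac_simps)

lemma vector_4:
  "(vector [a, b, c, d] :: 'a::zero ^ 4) $ 1 = a"
  "(vector [a, b, c, d] :: 'a ^ 4) $ 2 = b"
  "(vector [a, b, c, d] :: 'a ^ 4) $ 3 = c"
  "(vector [a, b, c, d] :: 'a ^ 4) $ 4 = d"
  by (simp_all add: vector_def)

lemma vector_5:
  "(vector [a, b, c, d, e] :: 'a::zero ^ 5) $ 1 = a"
  "(vector [a, b, c, d, e] :: 'a ^ 5) $ 2 = b"
  "(vector [a, b, c, d, e] :: 'a ^ 5) $ 3 = c"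
  "(vector [a, b, c, d, e] :: 'a ^ 5) $ 4 = d"
  "(vector [a, b, c, d, e] :: 'a ^ 5) $ 5 = e"
  by (simp_all add: vector_def)

lemma dot_vector_4:
  "dot x (vector [a, b, c, d] :: 'f::field ^ 4) = x $ 1 * a + x $ 2 * b + x $ 3 * c + x $ 4 * d"
  by (simp add: dot_def sum_4 vector_4)

lemma dot_vector_5:
  "dot x (vector [a, b, c, d, e] :: 'f::field ^ 5) =
     x $ 1 * a + x $ 2 * b + x $ 3 * c + x $ 4 * d + x $ 5 * e"
  by (simp add: dot_def sum_5 vector_5)

section \<open>The field with three elements\<close>

context
  assumes card_f: "CARD('f::field) = 3"
begin

text \<open>Otherwise \<open>0\<close>, \<open>a\<close>, \<open>b\<close> are all the elements of
  the field, yet \<open>a + b\<close> equals none of them.\<close>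

lemma card_3_cases:
  fixes a b :: 'f
  shows "a = 0 \<or> b = 0 \<or> a = b \<or> b = - a"
proof (rule ccontr)
  assume *: "\<not> ?thesis"
  have "finite (UNIV :: 'f set)"
    using card_f by (metis card.infinite zero_neq_numeral)
  moreover have "card {0, a, b} = 3"
    using * by simp
  ultimately have "{0, a, b} = UNIV"
    by (intro card_subset_eq) (auto simp: card_f)
  then have "a + b \<in> {0, a, b}"
    by auto
  then show False
    using * by (auto simp: add_eq_0_iff)
qed

text \<open>These rules evaluate the orthogonality tables below: the entries are 0, 1 and -1, with
  at most four nonzero terms in each sum.\<close>

lemma card_3_numerals: "(2 :: 'f) = - 1" "(3 :: 'f) = 0" "(4 :: 'f) = 1" "(- 1 :: 'f) \<noteq> 1"
proof -
  have "\<exists>c :: 'f. c \<notin> {0, 1}"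
  proof (rule ccontr)
    assume "\<not> ?thesis"
    then have "(UNIV :: 'f set) = {0, 1}"
      by auto
    then have "CARD('f) = card {0, 1 :: 'f}"
      by metis
    then show False
      using card_f by simp
  qed
  then obtain c :: 'f where c: "c \<noteq> 0" "c \<noteq> 1"
    by auto
  then have "c = - 1"
    using card_3_cases[of 1 c] by auto
  then show ne: "(- 1 :: 'f) \<noteq> 1"
    using c by simp
  have "(2 :: 'f) \<noteq> 0"
    using ne by (metis add_eq_0_iff one_add_one)
  moreover have "(2 :: 'f) \<noteq> 1"
    by (metis add_cancel_right_right one_add_one one_neq_zero)
  ultimately show "(2 :: 'f) = - 1"
    using card_3_cases[of 1 2] by auto
  then show "(3 :: 'f) = 0"
    by (metis add.commute add.right_inverse one_plus_numeral semiring_norm(3))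
  then show "(4 :: 'f) = 1"
    by (metis add.left_neutral numeral_plus_one semiring_norm(2) semiring_norm(8))
qed

lemma cover_7:
  fixes a b c d :: 'f
  shows "a = 0 \<or> b = 0 \<or> c = 0 \<or> d = 0 \<or> a - b = 0 \<or> c - d = 0 \<or> a + b + c + d = 0"
  using card_3_cases[of a b] card_3_cases[of c d] by auto

text \<open>If the first seven alternatives fail, signs alternate along \<open>a\<close>,
  \<open>b\<close>, \<open>c\<close>, \<open>d\<close>, so \<open>d = - a\<close>.\<close>

lemma cover_8:
  fixes a b c d :: 'f
  shows "a = 0 \<or> b = 0 \<or> c = 0 \<or> d = 0 \<or> a - b = 0 \<or> b - c = 0 \<or> c - d = 0 \<or> a + d = 0"
  using card_3_cases[of a b] card_3_cases[of b c] card_3_cases[of c d]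
  by auto

text \<open>If the first eight alternatives fail, then \<open>b = - a\<close>,
  \<open>d = - c\<close> and \<open>e = - d = c\<close>, so the last form vanishes.\<close>

lemma cover_9:
  fixes a b c d e :: 'f
  shows "a = 0 \<or> b = 0 \<or> c = 0 \<or> d = 0 \<or> e = 0 \<or>
    a - b = 0 \<or> c - d = 0 \<or> d - e = 0 \<or> a + b + c - e = 0"
  using card_3_cases[of a b] card_3_cases[of c d] card_3_cases[of d e]
  by auto

lemma pg_3_3_size_7:
  "\<exists>B :: ('f ^ 4) set set. nontrivial_blocking_set B \<and> minimal_blocking_set B \<and> card B = 7"
proof -
  \<comment> \<open>\<open>?vs\<close> lists the coefficients of the seven forms in
    \<open>cover_7\<close>, in that order; each vector of \<open>?ws\<close> is a zero of exactly
    one form, the one in the same position. The first three points are unit vectors, so the third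
    coordinate serves as \<open>c\<close>.\<close>
  let ?vs = "map vector [[1, 0, 0, 0], [0, 1, 0, 0], [0, 0, 1, 0], [0, 0, 0, 1],
      [1, -1, 0, 0], [0, 0, 1, -1], [1, 1, 1, 1]] :: ('f ^ 4) list"
  let ?ws = "map vector [[0, 1, 1, -1], [1, 0, 1, -1], [1, -1, 0, 1], [1, -1, 1, 0],
      [1, 1, 1, -1], [1, -1, 1, 1], [1, -1, 1, -1]] :: ('f ^ 4) list"
  show ?thesis
  proof (rule minimal_blocking_set_from_vectors[where ws = ?ws and c = "vector [0, 0, 1, 0]"])
    show "\<exists>v\<in>set ?vs. dot a v = 0" for a
      using cover_7[of "a $ 1" "a $ 2" "a $ 3" "a $ 4"] by (auto simp: dot_vector_4)
    show "map (\<lambda>w. map (\<lambda>v. dot w v = 0) ?vs) ?ws =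
        map (\<lambda>i. map ((=) i) [0..<7]) [0..<7]"
      by (simp add: dot_vector_4 vector_4 card_3_numerals upt_conv_Cons)
  qed (simp_all add: dot_vector_4 vector_4)
qed

lemma pg_3_3_size_8:
  "\<exists>B :: ('f ^ 4) set set. nontrivial_blocking_set B \<and> minimal_blocking_set B \<and> card B = 8"
proof -
  let ?vs = "map vector [[1, 0, 0, 0], [0, 1, 0, 0], [0, 0, 1, 0], [0, 0, 0, 1],
      [1, -1, 0, 0], [0, 1, -1, 0], [0, 0, 1, -1], [1, 0, 0, 1]] :: ('f ^ 4) list"
  let ?ws = "map vector [[0, 1, -1, 1], [1, 0, -1, 1], [1, -1, 0, 1], [1, -1, 1, 0],
      [1, 1, -1, 1], [1, -1, -1, 1], [1, -1, 1, 1], [1, -1, 1, -1]] :: ('f ^ 4) list"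
  show ?thesis
  proof (rule minimal_blocking_set_from_vectors[where ws = ?ws and c = "vector [0, 0, 1, 0]"])
    show "\<exists>v\<in>set ?vs. dot a v = 0" for a
      using cover_8[of "a $ 1" "a $ 2" "a $ 3" "a $ 4"] by (auto simp: dot_vector_4)
    show "map (\<lambda>w. map (\<lambda>v. dot w v = 0) ?vs) ?ws =
        map (\<lambda>i. map ((=) i) [0..<8]) [0..<8]"
      by (simp add: dot_vector_4 vector_4 card_3_numerals upt_conv_Cons)
  qed (simp_all add: dot_vector_4 vector_4)
qed

lemma pg_4_3_size_9:
  "\<exists>B :: ('f ^ 5) set set. nontrivial_blocking_set B \<and> minimal_blocking_set B \<and> card B = 9"
proof -
  let ?vs = "map vector [[1, 0, 0, 0, 0], [0, 1, 0, 0, 0], [0, 0, 1, 0, 0], [0, 0, 0, 1, 0],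
      [0, 0, 0, 0, 1], [1, -1, 0, 0, 0], [0, 0, 1, -1, 0], [0, 0, 0, 1, -1],
      [1, 1, 1, 0, -1]] :: ('f ^ 5) list"
  let ?ws = "map vector [[0, 1, 1, -1, 1], [1, 0, 1, -1, 1], [1, -1, 0, 1, -1], [1, -1, 1, 0, -1],
      [1, -1, 1, -1, 0], [1, 1, 1, -1, 1], [1, -1, 1, 1, -1], [1, -1, -1, 1, 1],
      [1, -1, 1, -1, 1]] :: ('f ^ 5) list"
  show ?thesis
  proof (rule minimal_blocking_set_from_vectors[where ws = ?ws and c = "vector [0, 0, 1, 0, 0]"])
    show "\<exists>v\<in>set ?vs. dot a v = 0" for a
      using cover_9[of "a $ 1" "a $ 2" "a $ 3" "a $ 4" "a $ 5"] by (auto simp: dot_vector_5)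
    show "map (\<lambda>w. map (\<lambda>v. dot w v = 0) ?vs) ?ws =
        map (\<lambda>i. map ((=) i) [0..<9]) [0..<9]"
      by (simp add: dot_vector_5 vector_5 card_3_numerals upt_conv_Cons)
  qed (simp_all add: dot_vector_5 vector_5)
qed

end

theorem theorem1p7:
  assumes "CARD('f::field) = 3"
  shows "(\<exists>B :: ('f ^ 4) set set.
            nontrivial_blocking_set B \<and> minimal_blocking_set B \<and> card B = 7) \<and>
         (\<exists>B :: ('f ^ 4) set set.
            nontrivial_blocking_set B \<and> minimal_blocking_set B \<and> card B = 8) \<and>
         (\<exists>B :: ('f ^ 5) set set.
            nontrivial_blocking_set B \<and> minimal_blocking_set B \<and> card B = 9)"
  using pg_3_3_size_7[OF assms] pg_3_3_size_8[OF assms] pg_4_3_size_9[OF assms] by blast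

end
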